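(* Let $R$ be any commutative unital ring. Every derivation of $\mathfrak{gl}_{cf}(\mathbb{N},R)$ is a sum of an inner derivation and a central derivation.
   Context: $\mathbb{N}$ denotes the positive integers; rings are associative. $\mathfrak{gl}_{cf}(\mathbb{N},R)$ is the set of all $\mathbb{N}\times\mathbb{N}$ matrices over $R$ having only finitely many nonzero entries in each column, regarded as a Lie algebra over $R$ with $[A,B]=AB-BA$. A derivation of $\mathfrak{gl}_{cf}(\mathbb{N},R)$ is an $R$-linear map $\varphi:\mathfrak{gl}_{cf}(\mathbb{N},R)\to\mathfrak{gl}_{cf}(\mathbb{N},R)$ with $\varphi([X,Y])=[\varphi(X),Y]+[X,\varphi(Y)]$ for all $X,Y$. An inner derivation is a map of the form $\mathrm{ad}\,A: X\mapsto[A,X]$ for a fixed $A\in\mathfrak{gl}_{cf}(\mathbb{N},R)$. A derivation is called central if its image is contained in the center of $\mathfrak{gl}_{cf}(\mathbb{N},R)$. *)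

theory Defs
  imports Main
begin

text \<open>
  Matrices indexed by the positive integers are represented as functions on
  \<open>nat\<close>, with \<open>X i j\<close> the entry in row \<open>i + 1\<close> and column \<open>j + 1\<close>.
  The sort \<open>{comm_ring, comm_monoid_mult}\<close> is that of commutative unital
  rings; unlike \<open>comm_ring_1\<close>, it does not exclude the zero ring.
\<close>

type_synonym 'a inf_mat = "nat \<Rightarrow> nat \<Rightarrow> 'a"

definition gl_cf :: "'a::zero inf_mat set" where
  "gl_cf = {X. \<forall>j. finite {i. X i j \<noteq> 0}}"

definition mat_zero :: "'a::zero inf_mat" where
  "mat_zero = (\<lambda>i j. 0)"

definition mat_add :: "'a::plus inf_mat \<Rightarrow> 'a inf_mat \<Rightarrow> 'a inf_mat" where
  "mat_add X Y = (\<lambda>i j. X i j + Y i j)"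

definition mat_diff :: "'a::minus inf_mat \<Rightarrow> 'a inf_mat \<Rightarrow> 'a inf_mat" where
  "mat_diff X Y = (\<lambda>i j. X i j - Y i j)"

definition mat_scale :: "'a::times \<Rightarrow> 'a inf_mat \<Rightarrow> 'a inf_mat" where
  "mat_scale c X = (\<lambda>i j. c * X i j)"

text \<open>
  The formally infinite sum over \<open>k\<close> is restricted to the support of column
  \<open>j\<close> of \<open>Y\<close>, which is finite whenever \<open>Y\<close> is in \<open>gl_cf\<close>.
\<close>

definition mat_mult :: "'a::semiring_0 inf_mat \<Rightarrow> 'a inf_mat \<Rightarrow> 'a inf_mat" where
  "mat_mult X Y = (\<lambda>i j. \<Sum>k\<in>{k. Y k j \<noteq> 0}. X i k * Y k j)"

definition bracket :: "'a::ring inf_mat \<Rightarrow> 'a inf_mat \<Rightarrow> 'a inf_mat" where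
  "bracket X Y = mat_diff (mat_mult X Y) (mat_mult Y X)"

lemma mat_mult_in_gl_cf:
  assumes "X \<in> gl_cf" "Y \<in> gl_cf"
  shows "mat_mult X Y \<in> gl_cf"
proof -
  have "finite {i. mat_mult X Y i j \<noteq> 0}" for j
  proof (rule finite_subset)
    show "{i. mat_mult X Y i j \<noteq> 0} \<subseteq> (\<Union>k\<in>{k. Y k j \<noteq> 0}. {i. X i k \<noteq> 0})"
    proof
      fix i assume "i \<in> {i. mat_mult X Y i j \<noteq> 0}"
      then obtain k where "Y k j \<noteq> 0" "X i k * Y k j \<noteq> 0"
        unfolding mat_mult_def by (auto elim: sum.not_neutral_contains_not_neutral)
      then show "i \<in> (\<Union>k\<in>{k. Y k j \<noteq> 0}. {i. X i k \<noteq> 0})"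
        by auto
    qed
    show "finite (\<Union>k\<in>{k. Y k j \<noteq> 0}. {i. X i k \<noteq> 0})"
      using assms by (auto simp: gl_cf_def)
  qed
  then show ?thesis by (simp add: gl_cf_def)
qed

lemma bracket_in_gl_cf:
  assumes "X \<in> gl_cf" "Y \<in> gl_cf"
  shows "bracket X Y \<in> gl_cf"
proof -
  have "finite {i. bracket X Y i j \<noteq> 0}" for j
  proof (rule finite_subset)
    show "{i. bracket X Y i j \<noteq> 0}
      \<subseteq> {i. mat_mult X Y i j \<noteq> 0} \<union> {i. mat_mult Y X i j \<noteq> 0}"
      by (auto simp: bracket_def mat_diff_def)
    show "finite ({i. mat_mult X Y i j \<noteq> 0} \<union> {i. mat_mult Y X i j \<noteq> 0})"
      using mat_mult_in_gl_cf[OF assms] mat_mult_in_gl_cf[OF assms(2,1)]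
      by (simp add: gl_cf_def)
  qed
  then show ?thesis by (simp add: gl_cf_def)
qed

definition gl_cf_center :: "'a::ring inf_mat set" where
  "gl_cf_center = {Z \<in> gl_cf. \<forall>X\<in>gl_cf. bracket Z X = mat_zero}"

text \<open>
  Maps on \<open>gl_cf\<close> are total functions on all infinite matrices; only their
  values on \<open>gl_cf\<close> matter in the following definitions.
\<close>

definition gl_cf_linear :: "('a::comm_ring inf_mat \<Rightarrow> 'a inf_mat) \<Rightarrow> bool" where
  "gl_cf_linear \<phi> \<longleftrightarrow>
    (\<forall>X\<in>gl_cf. \<phi> X \<in> gl_cf) \<and>
    (\<forall>X\<in>gl_cf. \<forall>Y\<in>gl_cf. \<phi> (mat_add X Y) = mat_add (\<phi> X) (\<phi> Y)) \<and>
    (\<forall>c. \<forall>X\<in>gl_cf. \<phi> (mat_scale c X) = mat_scale c (\<phi> X))"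

definition derivation :: "('a::comm_ring inf_mat \<Rightarrow> 'a inf_mat) \<Rightarrow> bool" where
  "derivation \<phi> \<longleftrightarrow> gl_cf_linear \<phi> \<and>
    (\<forall>X\<in>gl_cf. \<forall>Y\<in>gl_cf.
      \<phi> (bracket X Y) = mat_add (bracket (\<phi> X) Y) (bracket X (\<phi> Y)))"

definition inner_derivation :: "('a::comm_ring inf_mat \<Rightarrow> 'a inf_mat) \<Rightarrow> bool" where
  "inner_derivation \<phi> \<longleftrightarrow> (\<exists>A\<in>gl_cf. \<forall>X\<in>gl_cf. \<phi> X = bracket A X)"

definition central_derivation :: "('a::comm_ring inf_mat \<Rightarrow> 'a inf_mat) \<Rightarrow> bool" where
  "central_derivation \<phi> \<longleftrightarrow> derivation \<phi> \<and> (\<forall>X\<in>gl_cf. \<phi> X \<in> gl_cf_center)"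

end

theory Submission
  imports Defs
begin

text \<open>
  Write \<open>E i j\<close> for the matrix unit \<open>mat_unit i j\<close>. A derivation \<open>\<phi>\<close> is corrected twice by an inner
  derivation, until the remainder vanishes on all \<open>E i j\<close> with \<open>i \<noteq> j\<close>; such a remainder is
  necessarily central.

  The bracket with \<open>E k k\<close> only sees row \<open>k\<close> and column \<open>k\<close>. So there is a matrix \<open>A\<close>, built by taking
  its \<open>k\<close>-th column from \<open>\<phi> (E k k)\<close>, for which \<open>\<phi> - ad A\<close> sends \<open>E k k\<close> to a matrix whose column \<open>k\<close>
  vanishes off the diagonal. This \<open>A\<close> is column-finite precisely because only one column is taken from
  each \<open>\<phi> (E k k)\<close>. Since the \<open>E k k\<close> commute, every \<open>(\<phi> - ad A) (E k k)\<close> is then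
  diagonal (\<open>ex_inner_diagonalizing_idempotents\<close>).

  Such a derivation \<open>\<psi>\<close> has each off-diagonal unit as an eigenvector, \<open>\<psi> (E i j) = w i j E i j\<close>
  (\<open>derivation_unit_eigen\<close>). The arguments that exploit only \<open>E i i\<close> and \<open>E j j\<close> leave an entry at
  \<open>(j, i)\<close> that is merely killed by 2; passing through a third index, \<open>E i j = [E i k, E k j]\<close>,
  removes it over every ring. The same relation makes \<open>w\<close> additive, whence \<open>w i j = d i - d j\<close>,
  and \<open>\<psi>\<close> agrees on off-diagonal units with the bracket with the diagonal matrix of the \<open>d i\<close>
  (\<open>ex_inner_killing_off_diagonal_units\<close>).

  A derivation \<open>\<delta>\<close> that kills the off-diagonal units need not vanish on the matrices they fail
  to span, and \<open>[X, E i j]\<close> may have an infinite row. But \<open>[E k l, [X, E i j]]\<close> is a combination of two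
  off-diagonal units when \<open>i \<noteq> l\<close> and \<open>j \<noteq> k\<close>, and applying \<open>\<delta>\<close> to it shows that \<open>\<delta> X\<close> is
  diagonal, for every \<open>X\<close>. Then \<open>[\<delta> X, E i j] = \<delta> [X, E i j]\<close> is diagonal as well, while it is also a
  multiple of \<open>E i j\<close>; so it is zero, and the diagonal of \<open>\<delta> X\<close> is constant.
\<close>

section \<open>Column-finite matrices\<close>

lemma finite_column_support: "X \<in> gl_cf \<Longrightarrow> finite {i. X i j \<noteq> 0}"
  by (simp add: gl_cf_def)

lemma gl_cfI: "(\<And>j. \<exists>S. finite S \<and> (\<forall>i. i \<notin> S \<longrightarrow> X i j = 0)) \<Longrightarrow> X \<in> gl_cf"
  unfolding gl_cf_def
  by (smt (verit, best) finite_subset mem_Collect_eq subsetI)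

lemma mat_add_in_gl_cf:
  fixes X Y :: "'a::comm_ring inf_mat"
  assumes "X \<in> gl_cf" "Y \<in> gl_cf"
  shows "mat_add X Y \<in> gl_cf"
proof (rule gl_cfI)
  fix j
  show "\<exists>S. finite S \<and> (\<forall>i. i \<notin> S \<longrightarrow> mat_add X Y i j = 0)"
    by (rule exI[of _ "{i. X i j \<noteq> 0} \<union> {i. Y i j \<noteq> 0}"])
      (use assms in \<open>auto simp: mat_add_def gl_cf_def\<close>)
qed

lemma mat_diff_in_gl_cf:
  fixes X Y :: "'a::comm_ring inf_mat"
  assumes "X \<in> gl_cf" "Y \<in> gl_cf"
  shows "mat_diff X Y \<in> gl_cf"
proof (rule gl_cfI)
  fix j
  show "\<exists>S. finite S \<and> (\<forall>i. i \<notin> S \<longrightarrow> mat_diff X Y i j = 0)"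
    by (rule exI[of _ "{i. X i j \<noteq> 0} \<union> {i. Y i j \<noteq> 0}"])
      (use assms in \<open>auto simp: mat_diff_def gl_cf_def\<close>)
qed

lemma mat_scale_in_gl_cf:
  fixes X :: "'a::comm_ring inf_mat"
  assumes "X \<in> gl_cf"
  shows "mat_scale a X \<in> gl_cf"
proof (rule gl_cfI)
  fix j
  show "\<exists>S. finite S \<and> (\<forall>i. i \<notin> S \<longrightarrow> mat_scale a X i j = 0)"
    by (rule exI[of _ "{i. X i j \<noteq> 0}"])
      (use assms in \<open>auto simp: mat_scale_def gl_cf_def\<close>)
qed

text \<open>
  Products with different right factors are sums over different supports;
  enlarging these to a common finite set makes the sums comparable.
\<close>

lemma mat_mult_eq_sum:
  fixes X Y :: "'a::comm_ring inf_mat"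
  assumes "finite S" "\<And>k. k \<notin> S \<Longrightarrow> Y k j = 0"
  shows "mat_mult X Y i j = (\<Sum>k\<in>S. X i k * Y k j)"
  unfolding mat_mult_def
  by (rule sum.mono_neutral_left) (use assms in auto)

lemma mat_mult_add_right:
  fixes X Y Z :: "'a::comm_ring inf_mat"
  assumes "Y \<in> gl_cf" "Z \<in> gl_cf"
  shows "mat_mult X (mat_add Y Z) = mat_add (mat_mult X Y) (mat_mult X Z)"
proof (intro ext)
  fix i j
  let ?S = "{k. Y k j \<noteq> 0} \<union> {k. Z k j \<noteq> 0}"
  have "finite ?S"
    using assms by (simp add: gl_cf_def)
  note sums = mat_mult_eq_sum[OF this, of _ j X i]
  show "mat_mult X (mat_add Y Z) i j = mat_add (mat_mult X Y) (mat_mult X Z) i j"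
    using sums[of "mat_add Y Z"] sums[of Y] sums[of Z]
    by (simp add: mat_add_def distrib_left sum.distrib)
qed

lemma mat_mult_diff_right:
  fixes X Y Z :: "'a::comm_ring inf_mat"
  assumes "Y \<in> gl_cf" "Z \<in> gl_cf"
  shows "mat_mult X (mat_diff Y Z) = mat_diff (mat_mult X Y) (mat_mult X Z)"
proof (intro ext)
  fix i j
  let ?S = "{k. Y k j \<noteq> 0} \<union> {k. Z k j \<noteq> 0}"
  have "finite ?S"
    using assms by (simp add: gl_cf_def)
  note sums = mat_mult_eq_sum[OF this, of _ j X i]
  show "mat_mult X (mat_diff Y Z) i j = mat_diff (mat_mult X Y) (mat_mult X Z) i j"
    using sums[of "mat_diff Y Z"] sums[of Y] sums[of Z]
    by (simp add: mat_diff_def right_diff_distrib sum_subtractf)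
qed

lemma mat_mult_add_left:
  fixes X Y Z :: "'a::comm_ring inf_mat"
  shows "mat_mult (mat_add X Y) Z = mat_add (mat_mult X Z) (mat_mult Y Z)"
  by (simp add: mat_mult_def mat_add_def distrib_right sum.distrib)

lemma mat_mult_diff_left:
  fixes X Y Z :: "'a::comm_ring inf_mat"
  shows "mat_mult (mat_diff X Y) Z = mat_diff (mat_mult X Z) (mat_mult Y Z)"
  by (simp add: mat_mult_def mat_diff_def left_diff_distrib sum_subtractf)

lemma mat_mult_scale_left:
  fixes X Y :: "'a::comm_ring inf_mat"
  shows "mat_mult (mat_scale a X) Y = mat_scale a (mat_mult X Y)"
  by (simp add: mat_mult_def mat_scale_def sum_distrib_left mult.assoc)

lemma mat_mult_scale_right:
  fixes X Y :: "'a::comm_ring inf_mat"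
  assumes "Y \<in> gl_cf"
  shows "mat_mult X (mat_scale a Y) = mat_scale a (mat_mult X Y)"
proof (intro ext)
  fix i j
  let ?S = "{k. Y k j \<noteq> 0}"
  have "finite ?S"
    using assms by (simp add: gl_cf_def)
  note sums = mat_mult_eq_sum[OF this, of _ j X i]
  show "mat_mult X (mat_scale a Y) i j = mat_scale a (mat_mult X Y) i j"
    using sums[of "mat_scale a Y"] sums[of Y]
    by (simp add: mat_scale_def sum_distrib_left mult.left_commute)
qed

lemma mat_mult_assoc:
  fixes X Y Z :: "'a::comm_ring inf_mat"
  assumes "Y \<in> gl_cf" "Z \<in> gl_cf"
  shows "mat_mult (mat_mult X Y) Z = mat_mult X (mat_mult Y Z)"
proof (intro ext)
  fix i j
  let ?K = "{k. Z k j \<noteq> 0}"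
  let ?L = "\<Union>k\<in>?K. {l. Y l k \<noteq> 0}"
  have fin: "finite ?K" "finite ?L"
    using assms by (auto simp: gl_cf_def)
  have YZ: "mat_mult Y Z l j = 0" if "l \<notin> ?L" for l
    unfolding mat_mult_def using that by (auto intro!: sum.neutral)
  have XY: "mat_mult X Y i k = (\<Sum>l\<in>?L. X i l * Y l k)" if "k \<in> ?K" for k
    using that by (intro mat_mult_eq_sum fin) auto
  have "mat_mult (mat_mult X Y) Z i j = (\<Sum>k\<in>?K. (\<Sum>l\<in>?L. X i l * Y l k) * Z k j)"
    unfolding mat_mult_def[of _ Z] by (rule sum.cong) (use XY in auto)
  also have "\<dots> = (\<Sum>l\<in>?L. \<Sum>k\<in>?K. X i l * (Y l k * Z k j))"
    unfolding sum_distrib_right mult.assoc by (rule sum.swap)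
  also have "\<dots> = (\<Sum>l\<in>?L. X i l * mat_mult Y Z l j)"
    by (simp add: mat_mult_def[of Y Z] sum_distrib_left)
  also have "\<dots> = mat_mult X (mat_mult Y Z) i j"
    by (rule mat_mult_eq_sum[symmetric]) (use fin YZ in auto)
  finally show "mat_mult (mat_mult X Y) Z i j = mat_mult X (mat_mult Y Z) i j" .
qed

lemma bracket_add_left:
  fixes X Y Z :: "'a::comm_ring inf_mat"
  assumes "X \<in> gl_cf" "Y \<in> gl_cf"
  shows "bracket (mat_add X Y) Z = mat_add (bracket X Z) (bracket Y Z)"
  unfolding bracket_def mat_mult_add_left mat_mult_add_right[OF assms]
  by (simp add: mat_add_def mat_diff_def algebra_simps)

lemma bracket_add_right:
  fixes X Y Z :: "'a::comm_ring inf_mat"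
  assumes "Y \<in> gl_cf" "Z \<in> gl_cf"
  shows "bracket X (mat_add Y Z) = mat_add (bracket X Y) (bracket X Z)"
  unfolding bracket_def mat_mult_add_left mat_mult_add_right[OF assms]
  by (simp add: mat_add_def mat_diff_def algebra_simps)

lemma bracket_diff_left:
  fixes X Y Z :: "'a::comm_ring inf_mat"
  assumes "X \<in> gl_cf" "Y \<in> gl_cf"
  shows "bracket (mat_diff X Y) Z = mat_diff (bracket X Z) (bracket Y Z)"
  unfolding bracket_def mat_mult_diff_left mat_mult_diff_right[OF assms]
  by (simp add: mat_diff_def algebra_simps)

lemma bracket_diff_right:
  fixes X Y Z :: "'a::comm_ring inf_mat"
  assumes "Y \<in> gl_cf" "Z \<in> gl_cf"
  shows "bracket X (mat_diff Y Z) = mat_diff (bracket X Y) (bracket X Z)"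
  unfolding bracket_def mat_mult_diff_left mat_mult_diff_right[OF assms]
  by (simp add: mat_diff_def algebra_simps)

lemma bracket_scale_right:
  fixes X Y :: "'a::comm_ring inf_mat"
  assumes "X \<in> gl_cf" "Y \<in> gl_cf"
  shows "bracket X (mat_scale a Y) = mat_scale a (bracket X Y)"
  using assms
  by (simp add: bracket_def mat_mult_scale_left mat_mult_scale_right)
    (simp add: mat_scale_def mat_diff_def right_diff_distrib)

lemma bracket_jacobi:
  fixes A X Y :: "'a::comm_ring inf_mat"
  assumes "A \<in> gl_cf" "X \<in> gl_cf" "Y \<in> gl_cf"
  shows "bracket A (bracket X Y) = mat_add (bracket (bracket A X) Y) (bracket X (bracket A Y))"
  using assms
  by (simp add: bracket_def mat_mult_diff_left mat_mult_diff_right mat_mult_in_gl_cf mat_mult_assoc)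
    (simp add: mat_add_def mat_diff_def algebra_simps)

section \<open>Derivations\<close>

lemma derivation_in_gl_cf: "derivation \<phi> \<Longrightarrow> X \<in> gl_cf \<Longrightarrow> \<phi> X \<in> gl_cf"
  by (simp add: derivation_def gl_cf_linear_def)

lemma derivation_add:
  "derivation \<phi> \<Longrightarrow> X \<in> gl_cf \<Longrightarrow> Y \<in> gl_cf \<Longrightarrow> \<phi> (mat_add X Y) = mat_add (\<phi> X) (\<phi> Y)"
  by (simp add: derivation_def gl_cf_linear_def)

lemma derivation_scale:
  "derivation \<phi> \<Longrightarrow> X \<in> gl_cf \<Longrightarrow> \<phi> (mat_scale a X) = mat_scale a (\<phi> X)"
  by (simp add: derivation_def gl_cf_linear_def)

lemma derivation_bracket:
  "derivation \<phi> \<Longrightarrow> X \<in> gl_cf \<Longrightarrow> Y \<in> gl_cf \<Longrightarrow>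
    \<phi> (bracket X Y) = mat_add (bracket (\<phi> X) Y) (bracket X (\<phi> Y))"
  by (simp add: derivation_def)

lemma derivation_diff_inner:
  fixes \<phi> :: "'a::comm_ring inf_mat \<Rightarrow> 'a inf_mat"
  assumes \<phi>: "derivation \<phi>" and A: "A \<in> gl_cf"
  shows "derivation (\<lambda>X. mat_diff (\<phi> X) (bracket A X))"
  unfolding derivation_def gl_cf_linear_def
proof (intro conjI ballI allI)
  fix X :: "'a inf_mat" assume X: "X \<in> gl_cf"
  note X' = derivation_in_gl_cf[OF \<phi> X] bracket_in_gl_cf[OF A X]
  show "mat_diff (\<phi> X) (bracket A X) \<in> gl_cf"
    by (rule mat_diff_in_gl_cf[OF X'])
  show "mat_diff (\<phi> (mat_scale a X)) (bracket A (mat_scale a X))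
      = mat_scale a (mat_diff (\<phi> X) (bracket A X))" for a
    unfolding derivation_scale[OF \<phi> X] bracket_scale_right[OF A X]
    by (simp add: mat_scale_def mat_diff_def right_diff_distrib)
  fix Y :: "'a inf_mat" assume Y: "Y \<in> gl_cf"
  note Y' = derivation_in_gl_cf[OF \<phi> Y] bracket_in_gl_cf[OF A Y]
  show "mat_diff (\<phi> (mat_add X Y)) (bracket A (mat_add X Y))
      = mat_add (mat_diff (\<phi> X) (bracket A X)) (mat_diff (\<phi> Y) (bracket A Y))"
    unfolding derivation_add[OF \<phi> X Y] bracket_add_right[OF X Y]
    by (simp add: mat_add_def mat_diff_def algebra_simps)
  show "mat_diff (\<phi> (bracket X Y)) (bracket A (bracket X Y))
      = mat_add (bracket (mat_diff (\<phi> X) (bracket A X)) Y)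
          (bracket X (mat_diff (\<phi> Y) (bracket A Y)))"
    unfolding derivation_bracket[OF \<phi> X Y] bracket_jacobi[OF A X Y]
      bracket_diff_left[OF X'] bracket_diff_right[OF Y']
    by (simp add: mat_add_def mat_diff_def algebra_simps)
qed

section \<open>Brackets with matrix units\<close>

definition mat_unit :: "nat \<Rightarrow> nat \<Rightarrow> 'a::{comm_ring, comm_monoid_mult} inf_mat" where
  "mat_unit i j = (\<lambda>r c. if r = i \<and> c = j then 1 else 0)"

lemma mat_unit_in_gl_cf [simp]: "mat_unit i j \<in> gl_cf"
  by (rule gl_cfI, rule exI[of _ "{i}"]) (auto simp: mat_unit_def)

lemma mat_mult_unit_right:
  "mat_mult X (mat_unit i j) r c = (if c = j then X r i else 0)"
  by (subst mat_mult_eq_sum[where S = "{i}"]) (auto simp: mat_unit_def)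

lemma mat_mult_unit_left:
  assumes "X \<in> gl_cf"
  shows "mat_mult (mat_unit i j) X r c = (if r = i then X j c else 0)"
proof -
  have "mat_mult (mat_unit i j) X r c
      = (\<Sum>k\<in>insert j {k. X k c \<noteq> 0}. mat_unit i j r k * X k c)"
    by (rule mat_mult_eq_sum) (use assms in \<open>auto simp: gl_cf_def\<close>)
  also have "\<dots> = (\<Sum>k\<in>{j}. mat_unit i j r k * X k c)"
    by (rule sum.mono_neutral_right) (use assms in \<open>auto simp: gl_cf_def mat_unit_def\<close>)
  finally show ?thesis
    by (simp add: mat_unit_def)
qed

lemma bracket_unit_right:
  assumes "X \<in> gl_cf"
  shows "bracket X (mat_unit i j) r c
    = (if c = j then X r i else 0) - (if r = i then X j c else 0)"
  using assms by (simp add: bracket_def mat_diff_def mat_mult_unit_left mat_mult_unit_right)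

lemma bracket_unit_left:
  assumes "X \<in> gl_cf"
  shows "bracket (mat_unit i j) X r c
    = (if r = i then X j c else 0) - (if c = j then X r i else 0)"
  using assms by (simp add: bracket_def mat_diff_def mat_mult_unit_left mat_mult_unit_right)

lemma bracket_unit_unit:
  assumes "i \<noteq> l"
  shows "bracket (mat_unit i j) (mat_unit k l) = (if j = k then mat_unit i l else mat_zero)"
  using assms by (intro ext, simp add: bracket_unit_right) (auto simp: mat_unit_def mat_zero_def)

lemma mat_zero_in_gl_cf: "mat_zero \<in> gl_cf"
  by (simp add: gl_cf_def mat_zero_def)

lemma derivation_zero:
  assumes "derivation \<phi>"
  shows "\<phi> mat_zero = mat_zero"
  using derivation_scale[OF assms mat_zero_in_gl_cf, of 0]
  by (simp add: mat_scale_def mat_zero_def)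

lemma derivation_unit_bracket:
  assumes "derivation \<phi>"
  shows "\<phi> (bracket (mat_unit i j) (mat_unit k l)) r c
    = (if c = l then \<phi> (mat_unit i j) r k else 0) - (if r = k then \<phi> (mat_unit i j) l c else 0)
    + ((if r = i then \<phi> (mat_unit k l) j c else 0) - (if c = j then \<phi> (mat_unit k l) r i else 0))"
  by (simp add: derivation_bracket[OF assms] derivation_in_gl_cf[OF assms] mat_add_def
      bracket_unit_left bracket_unit_right)

section \<open>Normalizing a derivation on matrix units\<close>

text \<open>
  Off the diagonal, column \<open>k\<close> of \<open>bracket A (mat_unit k k)\<close> is column \<open>k\<close> of \<open>A\<close>, so the columns of
  \<open>A\<close> for different \<open>k\<close> can be prescribed independently. Once column \<open>k\<close> of the image of
  \<open>mat_unit k k\<close> is cleared for every \<open>k\<close>, the relation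
  \<open>bracket (mat_unit k k) (mat_unit c c) = mat_zero\<close> clears the other columns.
\<close>

lemma ex_inner_diagonalizing_idempotents:
  fixes \<phi> :: "'a::{comm_ring, comm_monoid_mult} inf_mat \<Rightarrow> 'a inf_mat"
  assumes \<phi>: "derivation \<phi>"
  obtains A where "A \<in> gl_cf"
    "\<And>k r c. r \<noteq> c \<Longrightarrow> mat_diff (\<phi> (mat_unit k k)) (bracket A (mat_unit k k)) r c = 0"
proof
  define A :: "'a inf_mat" where "A = (\<lambda>i k. if i = k then 0 else \<phi> (mat_unit k k) i k)"
  show A: "A \<in> gl_cf"
  proof (rule gl_cfI)
    fix j
    show "\<exists>S. finite S \<and> (\<forall>i. i \<notin> S \<longrightarrow> A i j = 0)"
      by (rule exI[of _ "{i. \<phi> (mat_unit j j) i j \<noteq> 0}"])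
        (use finite_column_support[OF derivation_in_gl_cf[OF \<phi> mat_unit_in_gl_cf]] in
          \<open>auto simp: A_def\<close>)
  qed
  define \<psi> where "\<psi> = (\<lambda>X. mat_diff (\<phi> X) (bracket A X))"
  have \<psi>: "derivation \<psi>"
    unfolding \<psi>_def by (rule derivation_diff_inner[OF \<phi> A])
  have column: "\<psi> (mat_unit k k) r k = 0" if "r \<noteq> k" for k r
    using that by (simp add: \<psi>_def mat_diff_def bracket_unit_right[OF A]) (simp add: A_def)
  fix k r c :: nat assume "r \<noteq> c"
  have "\<psi> (mat_unit k k) r c = 0"
  proof (cases "c = k")
    case True
    then show ?thesis
      using column \<open>r \<noteq> c\<close> by simp
  next
    case False
    then have "bracket (mat_unit k k) (mat_unit c c) = (mat_zero :: 'a inf_mat)"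
      by (simp add: bracket_unit_unit)
    then have "0 = \<psi> (bracket (mat_unit k k) (mat_unit c c)) r c"
      using derivation_zero[OF \<psi>] by (simp add: mat_zero_def)
    also have "\<dots> = \<psi> (mat_unit k k) r c"
      unfolding derivation_unit_bracket[OF \<psi>] using False \<open>r \<noteq> c\<close> column by simp
    finally show ?thesis
      by simp
  qed
  then show "mat_diff (\<phi> (mat_unit k k)) (bracket A (mat_unit k k)) r c = 0"
    by (simp add: \<psi>_def)
qed

lemma ex_fresh_nat: "finite S \<Longrightarrow> \<exists>k::nat. k \<notin> S"
  using ex_new_if_finite infinite_UNIV_nat by blast

text \<open>
  The entries of the image of \<open>mat_unit i j = bracket (mat_unit i k) (mat_unit k j)\<close>. All later
  information on units comes from choosing \<open>k\<close>: equal to \<open>i\<close>, equal to \<open>j\<close>, or different from both.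
\<close>

lemma derivation_unit_through:
  assumes \<psi>: "derivation \<psi>" and "i \<noteq> j"
  shows "\<psi> (mat_unit i j) r c
    = (if c = j then \<psi> (mat_unit i k) r k else 0) - (if r = k then \<psi> (mat_unit i k) j c else 0)
    + ((if r = i then \<psi> (mat_unit k j) k c else 0) - (if c = k then \<psi> (mat_unit k j) r i else 0))"
  using derivation_unit_bracket[OF \<psi>, of i k k j r c] \<open>i \<noteq> j\<close> by (simp add: bracket_unit_unit)

text \<open>
  An entry outside row \<open>i\<close> and column \<open>j\<close> is excluded by an intermediate index unrelated to all
  others. This includes the position \<open>(j, i)\<close>, where the choices \<open>k = i\<close> and \<open>k = j\<close> would only show
  that twice the entry vanishes. The rest of row \<open>i\<close> and of column \<open>j\<close> is excluded by going through
  \<open>mat_unit j j\<close> and \<open>mat_unit i i\<close>, whose images are diagonal.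
\<close>

lemma derivation_unit_eigen:
  assumes \<psi>: "derivation \<psi>"
    and diag: "\<And>k r c. r \<noteq> c \<Longrightarrow> \<psi> (mat_unit k k) r c = 0"
    and "i \<noteq> j" "(r, c) \<noteq> (i, j)"
  shows "\<psi> (mat_unit i j) r c = 0"
proof -
  consider "r \<noteq> i" "c \<noteq> j" | "r = i" "c \<noteq> j" | "r \<noteq> i" "c = j"
    using assms(4) by blast
  then show ?thesis
  proof cases
    case 1
    obtain k where "k \<notin> {i, j, r, c}"
      using ex_fresh_nat[of "{i, j, r, c}"] by auto
    then show ?thesis
      using 1 derivation_unit_through[OF \<psi> \<open>i \<noteq> j\<close>, of r c k] by auto
  next
    case 2
    then show ?thesis
      using derivation_unit_through[OF \<psi> \<open>i \<noteq> j\<close>, of r c j] \<open>i \<noteq> j\<close> diag by auto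
  next
    case 3
    then show ?thesis
      using derivation_unit_through[OF \<psi> \<open>i \<noteq> j\<close>, of r c i] \<open>i \<noteq> j\<close> diag by auto
  qed
qed

text \<open>
  Additivity is only available for distinct indices, so antisymmetry cannot be read off from
  \<open>w i i = 0\<close>. It comes from \<open>w j k = w j i + w i k = w j i + w i j + w j k\<close> with a third index \<open>k\<close>.
  The potential is then \<open>d i = w i 0\<close>, normalized by \<open>d 0 = 0\<close>.
\<close>

lemma cocycle_is_coboundary:
  fixes w :: "nat \<Rightarrow> nat \<Rightarrow> 'a::ab_group_add"
  assumes "\<And>i j k. i \<noteq> j \<Longrightarrow> j \<noteq> k \<Longrightarrow> i \<noteq> k \<Longrightarrow> w i j = w i k + w k j"
  obtains d where "\<And>i j. i \<noteq> j \<Longrightarrow> w i j = d i - d j"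
proof
  define d where "d i = (if i = 0 then 0 else w i 0)" for i
  have anti: "w i j = - w j i" if "i \<noteq> j" for i j
  proof -
    obtain k where "k \<notin> {i, j}"
      using ex_fresh_nat[of "{i, j}"] by auto
    then have "w j k = w j i + w i k" "w i k = w i j + w j k"
      using that assms[of j k i] assms[of i k j] by auto
    then have "w j i + w i j = 0"
      by (metis add.assoc add_cancel_left_left)
    then show ?thesis
      by (simp add: eq_neg_iff_add_eq_0 add.commute)
  qed
  fix i j :: nat assume "i \<noteq> j"
  then show "w i j = d i - d j"
    using assms[of i j 0] anti[of 0 j] by (cases "i = 0"; cases "j = 0") (auto simp: d_def)
qed

lemma ex_inner_killing_off_diagonal_units:
  fixes \<psi> :: "'a::{comm_ring, comm_monoid_mult} inf_mat \<Rightarrow> 'a inf_mat"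
  assumes \<psi>: "derivation \<psi>"
    and diag: "\<And>k r c. r \<noteq> c \<Longrightarrow> \<psi> (mat_unit k k) r c = 0"
  obtains A where "A \<in> gl_cf"
    "\<And>i j. i \<noteq> j \<Longrightarrow> mat_diff (\<psi> (mat_unit i j)) (bracket A (mat_unit i j)) = mat_zero"
proof -
  note eigen = derivation_unit_eigen[OF \<psi> diag]
  have "\<psi> (mat_unit i j) i j = \<psi> (mat_unit i k) i k + \<psi> (mat_unit k j) k j"
    if "i \<noteq> j" "j \<noteq> k" "i \<noteq> k" for i j k
    using that derivation_unit_through[OF \<psi> \<open>i \<noteq> j\<close>, of i j k] by simp
  then obtain d where d: "\<And>i j. i \<noteq> j \<Longrightarrow> \<psi> (mat_unit i j) i j = d i - d j"
    using cocycle_is_coboundary[of "\<lambda>i j. \<psi> (mat_unit i j) i j"] by blast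
  define A where "A = (\<lambda>i j. if i = j then d i else 0)"
  have A: "A \<in> gl_cf"
    by (rule gl_cfI, rule_tac x = "{j}" in exI) (simp add: A_def)
  show thesis
  proof (rule that[OF A], intro ext)
    fix i j r c :: nat assume "i \<noteq> j"
    show "mat_diff (\<psi> (mat_unit i j)) (bracket A (mat_unit i j)) r c = mat_zero r c"
      using eigen[OF _ \<open>i \<noteq> j\<close>, of r c] d[OF \<open>i \<noteq> j\<close>] \<open>i \<noteq> j\<close>
      by (cases "(r, c) = (i, j)")
        (auto simp: mat_diff_def mat_zero_def bracket_unit_right[OF A], auto simp: A_def)
  qed
qed

section \<open>Derivations vanishing on off-diagonal units\<close>

lemma scalar_in_center:
  fixes Z :: "'a::comm_ring inf_mat"
  assumes "\<And>i j. i \<noteq> j \<Longrightarrow> Z i j = 0" "\<And>i j. Z i i = Z j j"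
  shows "Z \<in> gl_cf_center"
proof -
  have Z: "Z \<in> gl_cf"
    by (rule gl_cfI, rule_tac x = "{j}" in exI) (simp add: assms(1))
  have "bracket Z X i j = 0" if X: "X \<in> gl_cf" for X i j
  proof -
    have "mat_mult Z X i j = (\<Sum>k\<in>insert i {k. X k j \<noteq> 0}. Z i k * X k j)"
      by (rule mat_mult_eq_sum) (use X in \<open>auto simp: gl_cf_def\<close>)
    also have "\<dots> = (\<Sum>k\<in>{i}. Z i k * X k j)"
      by (rule sum.mono_neutral_right) (use X assms(1) in \<open>auto simp: gl_cf_def\<close>)
    finally have "mat_mult Z X i j = Z i i * X i j"
      by simp
    moreover have "mat_mult X Z i j = X i j * Z j j"
      by (subst mat_mult_eq_sum[where S = "{j}"]) (auto simp: assms(1))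
    ultimately show ?thesis
      using assms(2)[of i j] by (simp add: bracket_def mat_diff_def mult.commute)
  qed
  then show ?thesis
    using Z by (auto simp: gl_cf_center_def mat_zero_def intro!: ext)
qed

text \<open>
  The inner bracket is a column of \<open>X\<close> minus a possibly infinite row of \<open>X\<close>, hence in general no
  finite combination of units. Bracketing once more leaves one entry of each.
\<close>

lemma bracket_bracket_units:
  fixes X :: "'a::{comm_ring, comm_monoid_mult} inf_mat"
  assumes "X \<in> gl_cf" "i \<noteq> l" "j \<noteq> k"
  shows "bracket (mat_unit k l) (bracket X (mat_unit i j))
    = mat_add (mat_scale (X l i) (mat_unit k j)) (mat_scale (X j k) (mat_unit i l))"
  using assms
  by (intro ext, simp add: bracket_unit_left bracket_unit_right bracket_in_gl_cf)
    (auto simp: mat_add_def mat_scale_def mat_unit_def)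

text \<open>
  As \<open>\<delta>\<close> kills both units, it passes through the double bracket, so that
  \<open>bracket (mat_unit k l) (bracket (\<delta> X) (mat_unit i j))\<close> is the image under \<open>\<delta>\<close> of a
  combination of off-diagonal units, that is, zero. Its entry at \<open>(k, j)\<close> is \<open>\<delta> X l i\<close>.
\<close>

lemma derivation_killing_off_diagonal_units_diagonal:
  fixes \<delta> :: "'a::{comm_ring, comm_monoid_mult} inf_mat \<Rightarrow> 'a inf_mat"
  assumes \<delta>: "derivation \<delta>"
    and kill: "\<And>i j. i \<noteq> j \<Longrightarrow> \<delta> (mat_unit i j) = mat_zero"
    and X: "X \<in> gl_cf" and "l \<noteq> i"
  shows "\<delta> X l i = 0"
proof -
  obtain j where j: "j \<notin> {i, l}"
    using ex_fresh_nat[of "{i, l}"] by auto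
  obtain k where k: "k \<notin> {i, l, j}"
    using ex_fresh_nat[of "{i, l, j}"] by auto
  have bracket_zero: "bracket mat_zero Y = mat_zero" "bracket Y mat_zero = mat_zero"
    for Y :: "'a inf_mat"
    by (simp_all add: bracket_def mat_mult_def mat_diff_def mat_zero_def)
  have add_zero: "mat_add mat_zero Y = Y" "mat_add Y mat_zero = Y" for Y :: "'a inf_mat"
    by (simp_all add: mat_add_def mat_zero_def)
  have scale_zero: "mat_scale a mat_zero = (mat_zero :: 'a inf_mat)" for a
    by (simp add: mat_scale_def mat_zero_def)
  have "mat_add (mat_scale (\<delta> X l i) (mat_unit k j)) (mat_scale (\<delta> X j k) (mat_unit i l))
      = bracket (mat_unit k l) (bracket (\<delta> X) (mat_unit i j))"
    using j k \<open>l \<noteq> i\<close> by (simp add: bracket_bracket_units derivation_in_gl_cf[OF \<delta> X])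
  also have "\<dots> = \<delta> (bracket (mat_unit k l) (bracket X (mat_unit i j)))"
    using j k X by (simp add: derivation_bracket[OF \<delta>] bracket_in_gl_cf kill bracket_zero add_zero)
  also have "\<dots> = \<delta> (mat_add (mat_scale (X l i) (mat_unit k j)) (mat_scale (X j k) (mat_unit i l)))"
    using j k \<open>l \<noteq> i\<close> by (simp add: bracket_bracket_units X)
  also have "\<dots> = mat_zero"
    using j k \<open>l \<noteq> i\<close>
    by (simp add: derivation_add[OF \<delta>] derivation_scale[OF \<delta>] mat_scale_in_gl_cf kill
        scale_zero add_zero)
  finally have "mat_add (mat_scale (\<delta> X l i) (mat_unit k j))
      (mat_scale (\<delta> X j k) (mat_unit i l)) k j = 0"
    by (simp add: mat_zero_def)
  then show ?thesis
    using j k by (simp add: mat_add_def mat_scale_def mat_unit_def)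
qed

text \<open>
  Diagonality is applied twice, to the image of \<open>X\<close> and to the image of \<open>bracket X (mat_unit i j)\<close>.
  The entry at \<open>(i, j)\<close> of the latter is the difference of two diagonal entries of the former.
\<close>

lemma derivation_killing_off_diagonal_units_central:
  fixes \<delta> :: "'a::{comm_ring, comm_monoid_mult} inf_mat \<Rightarrow> 'a inf_mat"
  assumes \<delta>: "derivation \<delta>"
    and kill: "\<And>i j. i \<noteq> j \<Longrightarrow> \<delta> (mat_unit i j) = mat_zero"
  shows "central_derivation \<delta>"
  unfolding central_derivation_def
proof (intro conjI ballI \<delta>)
  fix X :: "'a inf_mat" assume X: "X \<in> gl_cf"
  note diagonal = derivation_killing_off_diagonal_units_diagonal[OF \<delta> kill]
  show "\<delta> X \<in> gl_cf_center"
  proof (rule scalar_in_center)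
    show "\<delta> X i j = 0" if "i \<noteq> j" for i j
      using diagonal X that by simp
    show "\<delta> X i i = \<delta> X j j" for i j
    proof (cases "i = j")
      case False
      have "0 = \<delta> (bracket X (mat_unit i j)) i j"
        using diagonal bracket_in_gl_cf[OF X mat_unit_in_gl_cf] False by simp
      also have "\<dots> = \<delta> X i i - \<delta> X j j"
        using False
        by (simp add: derivation_bracket[OF \<delta> X] kill mat_add_def
            bracket_unit_right[OF derivation_in_gl_cf[OF \<delta> X]])
          (simp add: bracket_def mat_mult_def mat_diff_def mat_zero_def)
      finally show ?thesis
        by simp
    qed simp
  qed
qed

theorem theorem1p5:
  fixes \<phi> :: "'a::{comm_ring, comm_monoid_mult} inf_mat \<Rightarrow> 'a inf_mat"
  assumes "derivation \<phi>"
  shows "\<exists>\<iota> \<zeta>. inner_derivation \<iota> \<and> central_derivation \<zeta> \<and>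
    (\<forall>X\<in>gl_cf. \<phi> X = mat_add (\<iota> X) (\<zeta> X))"
proof -
  obtain A where A: "A \<in> gl_cf"
    and diag: "\<And>k r c. r \<noteq> c \<Longrightarrow>
      mat_diff (\<phi> (mat_unit k k)) (bracket A (mat_unit k k)) r c = 0"
    using ex_inner_diagonalizing_idempotents[OF assms] by blast
  define \<psi> where "\<psi> = (\<lambda>X. mat_diff (\<phi> X) (bracket A X))"
  have \<psi>: "derivation \<psi>"
    unfolding \<psi>_def by (rule derivation_diff_inner[OF assms A])
  obtain B where B: "B \<in> gl_cf"
    and kill: "\<And>i j. i \<noteq> j \<Longrightarrow>
      mat_diff (\<psi> (mat_unit i j)) (bracket B (mat_unit i j)) = mat_zero"
    using ex_inner_killing_off_diagonal_units[OF \<psi>] diag unfolding \<psi>_def by blast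
  define \<zeta> where "\<zeta> = (\<lambda>X. mat_diff (\<psi> X) (bracket B X))"
  have "derivation \<zeta>"
    unfolding \<zeta>_def by (rule derivation_diff_inner[OF \<psi> B])
  then have "central_derivation \<zeta>"
    by (rule derivation_killing_off_diagonal_units_central) (simp add: \<zeta>_def kill)
  moreover have "inner_derivation (bracket (mat_add A B))"
    unfolding inner_derivation_def using mat_add_in_gl_cf[OF A B] by blast
  moreover have "\<phi> X = mat_add (bracket (mat_add A B) X) (\<zeta> X)" for X
    unfolding bracket_add_left[OF A B] \<zeta>_def \<psi>_def
    by (simp add: mat_add_def mat_diff_def)
  ultimately show ?thesis
    by blast
qed

end
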